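(* Let $G$ be a connected graph of order $n\geq 3$, let $k\geq 3$ be an odd integer, and let $d$ be an integer with $1\leq d < k$ and $n\equiv d \pmod 2$. (1) If ($n \geq 9$ or $n=3$ or $n=7$) and $e(G)\geq \binom{n-1}{2}+1$, then $G$ is $k$-$d$-critical unless $G = K_1 \vee (K_{n-2}+K_1)$. (2) If $n\in\{4,6\}$ and $e(G)\geq \frac{3n^2-2n}{8}$, then $G$ is $k$-$d$-critical unless $G = K_{\frac{n}{2}} \vee \frac{n}{2}K_1$. (3) If $n=5$ and $e(G)\geq 7$, then $G$ is $k$-$d$-critical unless $G = K_2 \vee 3K_1$ or $G = K_1 \vee (K_3+K_1)$. (4) If $n=8$ and $e(G)\geq 22$, then $G$ is $k$-$d$-critical unless $G = K_4 \vee 4K_1$ or $G = K_1 \vee (K_6+K_1)$.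
   Context: All graphs are finite, simple and undirected. The order of $G$ is its number of vertices and $e(G)$ is its number of edges. $K_m$ is the complete graph on $m$ vertices, $G_1+G_2$ is the (vertex-disjoint) union, $mK_1$ is the graph consisting of $m$ isolated vertices, and the join $G_1\vee G_2$ is obtained from vertex-disjoint $G_1,G_2$ by adding all edges between $V(G_1)$ and $V(G_2)$. Equality of graphs means isomorphism. $E_G(v)$ is the set of edges of $G$ incident with $v$. A $k$-matching of $G$ is a function $f:E(G)\to\{0,1,\dots,k\}$ with $\sum_{e\in E_G(v)}f(e)\leq k$ for every $v\in V(G)$. For odd $k\ge 3$ and $1\le d\le k$ with $|V(G)|\equiv d\pmod 2$, $G$ is $k$-$d$-critical if for every $v\in V(G)$ there exists a $k$-matching $f$ of $G$ such that $\sum_{e\in E_G(v)}f(e)=k-d$ and $\sum_{e\in E_G(u)}f(e)=k$ for all $u\in V(G)\setminus\{v\}$. *)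

theory Defs
  imports Complex_Main
begin

record 'a ugraph =
  verts :: "'a set"
  edges :: "'a set set"

definition simple_graph :: "'a ugraph \<Rightarrow> bool" where
  "simple_graph G \<longleftrightarrow> finite (verts G) \<and> (\<forall>e\<in>edges G. e \<subseteq> verts G \<and> card e = 2)"

definition order :: "'a ugraph \<Rightarrow> nat" where
  "order G = card (verts G)"

definition num_edges :: "'a ugraph \<Rightarrow> nat" where
  "num_edges G = card (edges G)"

definition connected_graph :: "'a ugraph \<Rightarrow> bool" where
  "connected_graph G \<longleftrightarrow>
     (\<forall>u\<in>verts G. \<forall>v\<in>verts G. (u, v) \<in> {(x, y). {x, y} \<in> edges G}\<^sup>*)"

(* Equality of graphs in the statement is isomorphism; the two sides may have
   different vertex types. *)
definition graph_iso :: "'a ugraph \<Rightarrow> 'b ugraph \<Rightarrow> bool" (infix "\<simeq>\<^sub>G" 50) where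
  "G \<simeq>\<^sub>G H \<longleftrightarrow>
     (\<exists>\<phi>. bij_betw \<phi> (verts G) (verts H) \<and>
          (\<forall>u\<in>verts G. \<forall>v\<in>verts G. {u, v} \<in> edges G \<longleftrightarrow> {\<phi> u, \<phi> v} \<in> edges H))"

definition complete_graph :: "nat \<Rightarrow> nat ugraph" where
  "complete_graph m =
     \<lparr>verts = {..<m}, edges = {{u, v} | u v. u < m \<and> v < m \<and> u \<noteq> v}\<rparr>"

definition isolated_vertices :: "nat \<Rightarrow> nat ugraph" where
  "isolated_vertices m = \<lparr>verts = {..<m}, edges = {}\<rparr>"

(* Sum types make the two vertex sets disjoint, as union and join require. *)
definition graph_union :: "'a ugraph \<Rightarrow> 'b ugraph \<Rightarrow> ('a + 'b) ugraph" where
  "graph_union G H =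
     \<lparr>verts = Inl ` verts G \<union> Inr ` verts H,
      edges = (\<lambda>e. Inl ` e) ` edges G \<union> (\<lambda>e. Inr ` e) ` edges H\<rparr>"

definition graph_join :: "'a ugraph \<Rightarrow> 'b ugraph \<Rightarrow> ('a + 'b) ugraph" where
  "graph_join G H =
     \<lparr>verts = verts (graph_union G H),
      edges = edges (graph_union G H) \<union> {{Inl u, Inr v} | u v. u \<in> verts G \<and> v \<in> verts H}\<rparr>"

definition incident_edges :: "'a ugraph \<Rightarrow> 'a \<Rightarrow> 'a set set" where
  "incident_edges G v = {e \<in> edges G. v \<in> e}"

(* The values of f outside the edge set are irrelevant. *)
definition k_matching :: "nat \<Rightarrow> 'a ugraph \<Rightarrow> ('a set \<Rightarrow> nat) \<Rightarrow> bool" where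
  "k_matching k G f \<longleftrightarrow>
     (\<forall>e\<in>edges G. f e \<in> {0..k}) \<and>
     (\<forall>v\<in>verts G. (\<Sum>e\<in>incident_edges G v. f e) \<le> k)"

(* Meant for odd k >= 3 and 1 <= d <= k with d of the parity of the order of G;
   in particular k - d is not truncated. *)
definition k_d_critical :: "nat \<Rightarrow> nat \<Rightarrow> 'a ugraph \<Rightarrow> bool" where
  "k_d_critical k d G \<longleftrightarrow>
     (\<forall>v\<in>verts G. \<exists>f. k_matching k G f \<and>
        (\<Sum>e\<in>incident_edges G v. f e) = k - d \<and>
        (\<forall>u\<in>verts G - {v}. (\<Sum>e\<in>incident_edges G u. f e) = k))"

end

(*
The hypotheses say that the complement of G has at most n - 2 edges (at most n - 3 for
n = 4, 6), and excluding the listed graphs leaves G with minimum degree at least 2 and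
without the few independent sets that this count would allow.

For n odd every G - v has a perfect matching M_v. Fix a neighbour w of v; then
M_v + M_w + vw has all vertex sums 2, and (k-d)/2 (M_v + M_w + vw) + d M_v is the required
k-matching. For n even G has a perfect matching M and G - v has a perfect 2-matching N, and
(k-d) M + (d/2) N works.

If a maximum matching misses x and y, it cannot be augmented along x, z, z', y for any
matching edge zz', so every vertex other than x, y accounts for its own nonedge at x or y.
For the perfect 2-matching let v' be the partner of v in M: either M - vv' can be repaired
around v' by a triangle, a 5-cycle, or an edge and a triangle, or there are too many
nonedges, or there is an independent set of n/2 vertices.
*)

theory Submission
  imports Defs
begin

section \<open>Adjacency, nonedges and independent sets\<close>

locale edge_set =
  fixes E :: "'a set set"
  assumes card_edge: "e \<in> E \<Longrightarrow> card e = 2"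
begin

definition adj :: "'a \<Rightarrow> 'a \<Rightarrow> bool" where
  "adj x y \<longleftrightarrow> {x, y} \<in> E"

lemma adj_sym: "adj x y \<longleftrightarrow> adj y x"
  by (simp add: adj_def insert_commute)

lemma adj_irrefl [simp]: "\<not> adj x x"
  using card_edge[of "{x}"] by (auto simp: adj_def)

text \<open>The vertex set is an argument, so that the same count serves the whole graph and the
  graph with one vertex deleted.\<close>

definition nonedges :: "'a set \<Rightarrow> 'a set set" where
  "nonedges S = {e. e \<subseteq> S \<and> card e = 2 \<and> e \<notin> E}"

lemma finite_nonedges [simp]: "finite S \<Longrightarrow> finite (nonedges S)"
  by (rule finite_subset[of _ "Pow S"]) (auto simp: nonedges_def)

lemma pair_in_nonedges: "{x, y} \<in> nonedges S \<longleftrightarrow> x \<in> S \<and> y \<in> S \<and> x \<noteq> y \<and> \<not> adj x y"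
  by (cases "x = y") (auto simp: nonedges_def adj_def)

lemma nonedges_mono: "S \<subseteq> T \<Longrightarrow> nonedges S \<subseteq> nonedges T"
  by (auto simp: nonedges_def)

definition independent :: "'a set \<Rightarrow> bool" where
  "independent T \<longleftrightarrow> (\<forall>x\<in>T. \<forall>y\<in>T. \<not> adj x y)"

lemma independent_nonedges:
  assumes "independent T"
  shows "nonedges T = {e. e \<subseteq> T \<and> card e = 2}"
  using assms by (auto simp: nonedges_def independent_def adj_def card_2_iff)

subsection \<open>Perfect matchings\<close>

text \<open>A perfect matching of \<open>S\<close>, encoded as an involution sending each vertex to
  its partner; fixed points are impossible because \<open>adj\<close> is irreflexive.\<close>

definition pairing :: "('a \<Rightarrow> 'a) \<Rightarrow> 'a set \<Rightarrow> bool" where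
  "pairing p S \<longleftrightarrow> (\<forall>z\<in>S. p z \<in> S \<and> p (p z) = z \<and> adj z (p z))"

definition matched :: "'a set \<Rightarrow> bool" where
  "matched S \<longleftrightarrow> (\<exists>p. pairing p S)"

lemma pairing_neq: "pairing p S \<Longrightarrow> z \<in> S \<Longrightarrow> p z \<noteq> z"
  unfolding pairing_def by (metis adj_irrefl)

lemma pairing_remove:
  assumes "pairing p S" "z \<in> S"
  shows "pairing p (S - {z, p z})"
  using assms unfolding pairing_def by (metis Diff_iff insert_iff singletonD)

lemma matched_empty: "matched {}"
  by (auto simp: matched_def pairing_def)

lemma matched_pair: "adj a b \<Longrightarrow> matched {a, b}"
  unfolding matched_def pairing_def
  by (rule exI[of _ "\<lambda>z. if z = a then b else a"]) (auto simp: adj_sym)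

lemma matched_Un:
  assumes "matched S" "matched T" "S \<inter> T = {}"
  shows "matched (S \<union> T)"
proof -
  obtain p q where p: "pairing p S" and q: "pairing q T"
    using assms(1,2) by (auto simp: matched_def)
  have "pairing (\<lambda>z. if z \<in> S then p z else q z) (S \<union> T)"
    using p q assms(3) unfolding pairing_def by auto
  then show ?thesis by (auto simp: matched_def)
qed

lemma matched_add_pair:
  assumes "matched S" "adj a b" "a \<notin> S" "b \<notin> S"
  shows "matched (insert a (insert b S))"
  using matched_Un[OF assms(1) matched_pair[OF assms(2)]] assms(3,4) by (simp add: Un_commute)

lemma even_card_pairing:
  assumes "finite S" "pairing p S"
  shows "even (card S)"
  using assms
proof (induction "card S" arbitrary: S rule: less_induct)
  case less
  show ?case
  proof (cases "S = {}")
    case False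
    then obtain z where z: "z \<in> S" by blast
    have pz: "p z \<in> S" "p z \<noteq> z"
      using less.prems z pairing_neq by (auto simp: pairing_def)
    have c: "card S = card (S - {z, p z}) + 2"
      using less.prems(1) z pz card_mono[of S "{z, p z}"] by (auto simp: card_Diff_subset)
    then have "even (card (S - {z, p z}))"
      using less.hyps less.prems pairing_remove[OF _ z] by auto
    with c show ?thesis by simp
  qed auto
qed

text \<open>A maximum matching missing x and y forces \<open>card S - 1\<close> nonedges, hence all
  that \<open>few\<close> allows; the structure is then rigid enough for an augmenting path through
  two matching edges. \<open>no_iso\<close> excludes a clique plus an isolated vertex and
  \<open>four\<close> the star on four vertices, which both satisfy \<open>few\<close> without
  having a perfect matching.\<close>

lemma near_complete_matched:
  assumes fin: "finite S" and ev: "even (card S)"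
    and few: "card (nonedges S) < card S"
    and no_iso: "\<And>x. x \<in> S \<Longrightarrow> \<exists>y\<in>S. adj x y"
    and four: "\<And>T. card S = 4 \<Longrightarrow> T \<subseteq> S \<Longrightarrow> card T = 3 \<Longrightarrow> \<not> independent T"
  shows "matched S"
proof -
  have "\<exists>M. (M \<subseteq> S \<and> matched M) \<and> (\<forall>M'. M' \<subseteq> S \<and> matched M' \<longrightarrow> card M' \<le> card M)"
    by (rule ex_has_greatest_nat[of _ "{}" _ "Suc (card S)"])
       (auto simp: matched_empty card_mono[OF fin] less_Suc_eq_le)
  then obtain M where M: "M \<subseteq> S" "matched M"
    and max: "\<And>M'. M' \<subseteq> S \<Longrightarrow> matched M' \<Longrightarrow> card M' \<le> card M" by blast
  have finM: "finite M" using M(1) fin finite_subset by blast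
  obtain p where p: "pairing p M" using M(2) by (auto simp: matched_def)
  have pM: "p z \<in> M" "p (p z) = z" "adj z (p z)" "p z \<noteq> z" if "z \<in> M" for z
    using p that pairing_neq by (auto simp: pairing_def)
  show ?thesis
  proof (cases "M = S")
    case True
    with M show ?thesis by simp
  next
    case False
    have "even (card M)" using even_card_pairing[OF finM p] .
    moreover have "card M < card S" using False M(1) fin by (simp add: psubset_card_mono)
    ultimately have "card M + 2 \<le> card S" using ev by presburger
    then have "2 \<le> card (S - M)" using finM M(1) by (simp add: card_Diff_subset)
    then obtain D where "D \<subseteq> S - M" "card D = 2"
      using obtain_subset_with_card_n by metis
    then obtain x y where xy: "x \<in> S" "y \<in> S" "x \<notin> M" "y \<notin> M" "x \<noteq> y"
      by (auto simp: card_2_iff)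
    have no_augment: False if "matched M'" "M' = insert x (insert y M)" for M'
      using max[of M'] that xy M(1) finM by auto
    have unmatched: "\<not> adj s t" if "s \<in> S - M" "t \<in> S - M" for s t
    proof
      assume st: "adj s t"
      then have "s \<noteq> t" by auto
      then show False
        using max[OF _ matched_add_pair[OF M(2) st]] that M(1) finM by auto
    qed
    \<comment> \<open>Extending the pairing by the identity treats the remaining unmatched vertices uniformly.\<close>
    define q where "q z = (if z \<in> M then p z else z)" for z
    have qq: "q (q z) = z" for z by (auto simp: q_def pM)
    have qS: "q z \<in> S - {x, y}" if "z \<in> S - {x, y}" for z
      using that pM xy M(1) by (auto simp: q_def)
    \<comment> \<open>Otherwise x, z, \<open>p z\<close>, y is an augmenting path; an unmatched z is
      not adjacent to x at all.\<close>
    have not_both: "\<not> adj x z \<or> \<not> adj y (q z)" if z: "z \<in> S - {x, y}" for z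
    proof (cases "z \<in> M")
      case True
      have False if "adj x z" "adj y (p z)"
      proof -
        have "matched (M - {z, p z})" using pairing_remove[OF p True] by (auto simp: matched_def)
        then have "matched (insert x (insert z (M - {z, p z})))"
          by (rule matched_add_pair) (use that xy in auto)
        then have "matched (insert y (insert (p z) (insert x (insert z (M - {z, p z})))))"
          by (rule matched_add_pair) (use that xy pM[OF True] True in auto)
        moreover have "insert y (insert (p z) (insert x (insert z (M - {z, p z})))) = insert x (insert y M)"
          using True pM[OF True] by auto
        ultimately show False using no_augment by simp
      qed
      then show ?thesis using True by (auto simp: q_def)
    next
      case False
      then show ?thesis using unmatched xy z by auto
    qed
    \<comment> \<open>Each z is charged the nonedge supplied by \<open>not_both\<close>. The end x
      or y tells the two kinds apart and the involution \<open>q\<close> recovers z, so the charges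
      are distinct.\<close>
    define g where "g z = (if adj x z then {y, q z} else {x, z})" for z
    define I where "I = insert {x, y} (g ` (S - {x, y}))"
    have inj: "inj_on g (S - {x, y})"
    proof (rule inj_onI)
      fix s t assume st: "s \<in> S - {x, y}" "t \<in> S - {x, y}" "g s = g t"
      have "q s = q t \<or> s = t"
        using st qS[OF st(1)] qS[OF st(2)] xy(5)
        by (auto simp: g_def doubleton_eq_iff split: if_splits)
      then show "s = t" using qq by metis
    qed
    have xy_notin: "{x, y} \<notin> g ` (S - {x, y})"
      using qS xy by (fastforce simp: g_def doubleton_eq_iff split: if_splits)
    have I_sub: "I \<subseteq> nonedges S"
      using xy unmatched[of x y] not_both qS
      by (fastforce simp: I_def g_def pair_in_nonedges)
    have card_I: "card I = card S - 1"
      using xy_notin fin xy card_mono[of S "{x, y}"]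
      by (simp add: I_def card_image[OF inj] card_Diff_subset)
    \<comment> \<open>The count is tight, so the nonedges are exactly known and a longer augmentation is possible.\<close>
    have "card S > 0" using fin xy by (auto simp: card_gt_0_iff)
    then have "I = nonedges S"
      using I_sub card_I few by (intro card_seteq finite_nonedges fin) auto
    have meets: "x \<in> e \<or> y \<in> e" if "e \<in> I" for e
      using that by (auto simp: I_def g_def)
    have inside: "adj s t" if "s \<in> S - {x, y}" "t \<in> S - {x, y}" "s \<noteq> t" for s t
    proof (rule ccontr)
      assume "\<not> adj s t"
      then have "{s, t} \<in> I" using that \<open>I = nonedges S\<close> by (auto simp: pair_in_nonedges)
      then show False using meets[of "{s, t}"] that by auto
    qed
    \<comment> \<open>If both pairs were nonedges, z would be charged {x, z}, and no other vertex
      can be charged {y, \<open>q z\<close>}, which would exceed the tight count.\<close>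
    have one: "adj x z \<longleftrightarrow> \<not> adj y (q z)" if z: "z \<in> S - {x, y}" for z
    proof (rule ccontr)
      assume "\<not> ?thesis"
      then have nn: "\<not> adj x z" "\<not> adj y (q z)" using not_both[OF z] by auto
      have "{y, q z} \<in> I"
        using nn z qS[OF z] xy \<open>I = nonedges S\<close> by (auto simp: pair_in_nonedges)
      then obtain t where t: "t \<in> S - {x, y}" "{y, q z} = g t"
        using qS[OF z] xy by (auto simp: I_def doubleton_eq_iff)
      then have "adj x t \<and> q z = q t"
        using qS[OF z] qS[OF t(1)] xy by (auto simp: g_def doubleton_eq_iff split: if_splits)
      then show False using nn qq by metis
    qed
    \<comment> \<open>An unmatched z has \<open>q z = z\<close>, so \<open>one\<close> would make it
      adjacent to x or y, which are unmatched too.\<close>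
    have full: "z \<in> M" if "z \<in> S - {x, y}" for z
      using one[OF that] unmatched[of x z] unmatched[of y z] that xy by (auto simp: q_def)
    obtain z where z: "z \<in> S - {x, y}" "\<not> adj x z"
    proof -
      obtain t where "t \<in> S" "adj y t" using no_iso[OF xy(2)] by blast
      then have "t \<in> S - {x, y}" using unmatched[of x y] xy adj_sym by auto
      then show ?thesis using that[of "q t"] one[of "q t"] qS[of t] qq \<open>adj y t\<close> by auto
    qed
    obtain w where w: "w \<in> S - {x, y}" "adj x w"
      using no_iso[OF xy(1)] unmatched[of x y] xy by (metis Diff_iff adj_irrefl empty_iff insert_iff)
    \<comment> \<open>If w is the partner of z, a further vertex u replaces w or z, according to
      whether u is adjacent to x. Such a u exists, since with only four vertices x, y, z would be
      independent.\<close>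
    have "\<exists>z w. z \<in> S - {x, y} \<and> w \<in> S - {x, y} \<and> \<not> adj x z \<and> adj x w \<and> w \<noteq> p z"
    proof (cases "w = p z")
      case True
      have "z \<noteq> w" using z w by auto
      then have card4: "card {x, y, z, w} = 4" using xy z w by auto
      have "card S \<noteq> 4"
      proof
        assume S4: "card S = 4"
        have "p z = q z" using full[OF z(1)] by (simp add: q_def)
        then have "\<not> adj y z"
          using one[OF w(1)] w True qq[of z] by simp
        then have "independent {x, y, z}"
          using z unmatched[of x y] xy adj_sym by (auto simp: independent_def)
        moreover have "card {x, y, z} = 3" using z xy by auto
        ultimately show False using four[OF S4, of "{x, y, z}"] z xy by auto
      qed
      moreover have "card {x, y, z, w} \<le> card S"
        using fin xy z w by (intro card_mono) auto
      ultimately have "\<not> S \<subseteq> {x, y, z, w}"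
        using card4 card_mono[of "{x, y, z, w}" S] by auto
      then obtain u where u: "u \<in> S - {x, y}" "u \<noteq> z" "u \<noteq> w" by auto
      have "p u \<noteq> p z" using pM(2)[OF full[OF u(1)]] pM(2)[OF full[OF z(1)]] u by metis
      then show ?thesis using u z w True by metis
    qed (use z w in blast)
    then obtain z w where zw: "z \<in> S - {x, y}" "w \<in> S - {x, y}" "\<not> adj x z" "adj x w" "w \<noteq> p z"
      by blast
    have zM: "z \<in> M" and wM: "w \<in> M" using full zw by auto
    have neq: "z \<noteq> w" using zw by auto
    then have neq': "p z \<noteq> p w" "z \<noteq> p w" using zw(5) pM(2)[OF zM] pM(2)[OF wM] by metis+
    \<comment> \<open>The augmenting path is x, w, \<open>p w\<close>, z, \<open>p z\<close>, y; its
      middle edge comes from \<open>inside\<close> and its last one from \<open>one\<close>.\<close>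
    define M0 where "M0 = M - {z, p z} - {w, p w}"
    have "pairing p M0"
      unfolding M0_def by (intro pairing_remove p zM) (use wM neq neq' zw in auto)
    then have "matched M0" by (auto simp: matched_def)
    then have "matched (insert x (insert w M0))"
      by (rule matched_add_pair) (use zw xy in \<open>auto simp: M0_def\<close>)
    then have "matched (insert y (insert (p z) (insert x (insert w M0))))"
    proof (rule matched_add_pair)
      show "adj y (p z)" using one[OF zw(1)] zw zM by (simp add: q_def)
    qed (use zw xy pM[OF zM] in \<open>auto simp: M0_def\<close>)
    then have "matched (insert z (insert (p w) (insert y (insert (p z) (insert x (insert w M0))))))"
    proof (rule matched_add_pair)
      show "adj z (p w)" using inside[OF zw(1), of "p w"] qS[OF zw(2)] neq' wM by (simp add: q_def)
    qed (use zw xy pM[OF zM] pM[OF wM] neq neq' in \<open>auto simp: M0_def\<close>)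
    moreover have "insert z (insert (p w) (insert y (insert (p z) (insert x (insert w M0)))))
        = insert x (insert y M)"
      using pM[OF zM] pM[OF wM] zM wM by (auto simp: M0_def)
    ultimately show ?thesis using no_augment by blast
  qed
qed

subsection \<open>Vertex sums of edge weightings\<close>

text \<open>A symmetric weight on ordered pairs stands for a function on edges, so that weightings
  add pointwise and vertex sums range over all of \<open>V\<close>. The vertex sums themselves bound
  the single weights.\<close>

definition realizable :: "'a set \<Rightarrow> ('a \<Rightarrow> nat) \<Rightarrow> bool" where
  "realizable V b \<longleftrightarrow> (\<exists>w :: 'a \<Rightarrow> 'a \<Rightarrow> nat.
     (\<forall>x y. w x y = w y x) \<and> (\<forall>x y. w x y \<noteq> 0 \<longrightarrow> adj x y) \<and>
     (\<forall>x\<in>V. (\<Sum>y\<in>V. w x y) = b x))"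

lemma realizable_cong:
  "realizable V b \<Longrightarrow> (\<And>x. x \<in> V \<Longrightarrow> b x = c x) \<Longrightarrow> realizable V c"
  by (auto simp: realizable_def)

lemma realizable_add:
  assumes "realizable V b" "realizable V c"
  shows "realizable V (\<lambda>x. b x + c x)"
proof -
  obtain w w' :: "'a \<Rightarrow> 'a \<Rightarrow> nat" where
    "\<forall>x y. w x y = w y x" "\<forall>x y. w x y \<noteq> 0 \<longrightarrow> adj x y" "\<forall>x\<in>V. (\<Sum>y\<in>V. w x y) = b x"
    "\<forall>x y. w' x y = w' y x" "\<forall>x y. w' x y \<noteq> 0 \<longrightarrow> adj x y" "\<forall>x\<in>V. (\<Sum>y\<in>V. w' x y) = c x"
    using assms unfolding realizable_def by blast
  then show ?thesis
    unfolding realizable_def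
    by (intro exI[of _ "\<lambda>x y. w x y + w' x y"]) (auto simp: sum.distrib)
qed

lemma realizable_mult:
  assumes "realizable V b"
  shows "realizable V (\<lambda>x. m * b x)"
proof -
  obtain w :: "'a \<Rightarrow> 'a \<Rightarrow> nat" where
    "\<forall>x y. w x y = w y x" "\<forall>x y. w x y \<noteq> 0 \<longrightarrow> adj x y" "\<forall>x\<in>V. (\<Sum>y\<in>V. w x y) = b x"
    using assms unfolding realizable_def by blast
  then show ?thesis
    unfolding realizable_def
    by (intro exI[of _ "\<lambda>x y. m * w x y"]) (auto simp: sum_distrib_left[symmetric])
qed

lemma realizable_matched:
  assumes "finite V" "S \<subseteq> V" "matched S"
  shows "realizable V (\<lambda>x. of_bool (x \<in> S))"
proof -
  obtain p where p: "pairing p S" using assms(3) by (auto simp: matched_def)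
  define w :: "'a \<Rightarrow> 'a \<Rightarrow> nat" where "w x y = of_bool (x \<in> S \<and> p x = y)" for x y
  have "w x y = w y x" for x y
    using p by (auto simp: w_def pairing_def)
  moreover have "w x y \<noteq> 0 \<longrightarrow> adj x y" for x y
    using p by (auto simp: w_def pairing_def)
  moreover have "(\<Sum>y\<in>V. w x y) = of_bool (x \<in> S)" for x
  proof (cases "x \<in> S")
    case True
    then have "p x \<in> V" using p assms(2) by (auto simp: pairing_def)
    then have "(\<Sum>y\<in>V. if p x = y then 1 else 0 :: nat) = 1"
      using assms(1) by (simp add: sum.delta)
    with True show ?thesis by (simp add: w_def of_bool_def)
  qed (simp add: w_def)
  ultimately show ?thesis unfolding realizable_def by blast
qed

lemma realizable_edge:
  assumes "finite V" "a \<in> V" "b \<in> V" "adj a b"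
  shows "realizable V (\<lambda>x. of_bool (x \<in> {a, b}))"
  using assms by (intro realizable_matched matched_pair) auto

section \<open>Perfect 2-matchings\<close>

text \<open>A perfect 2-matching of \<open>S\<close>, assembled below from doubled edges and from
  odd cycles with weight 1 on each edge. The sums vanish on the rest of \<open>V\<close>, so covers
  of disjoint sets can be added.\<close>

abbreviation two_covered :: "'a set \<Rightarrow> 'a set \<Rightarrow> bool" where
  "two_covered V S \<equiv> realizable V (\<lambda>x. 2 * of_bool (x \<in> S))"

lemma two_covered_Un:
  assumes "two_covered V S" "two_covered V T" "S \<inter> T = {}"
  shows "two_covered V (S \<union> T)"
  using realizable_add[OF assms(1,2)] by (rule realizable_cong) (use assms(3) in auto)

lemma two_covered_matched: "finite V \<Longrightarrow> S \<subseteq> V \<Longrightarrow> matched S \<Longrightarrow> two_covered V S"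
  by (intro realizable_mult realizable_matched)

lemma two_covered_triangle:
  assumes "finite V" "{a, b, c} \<subseteq> V" "adj a b" "adj b c" "adj c a"
  shows "two_covered V {a, b, c}"
proof -
  have "a \<noteq> b" "b \<noteq> c" "c \<noteq> a" using assms by auto
  then show ?thesis
    using assms
    by (intro realizable_cong[OF realizable_add[OF realizable_add[OF realizable_edge[of V a b]
      realizable_edge[of V b c]] realizable_edge[of V c a]]]) auto
qed

lemma two_covered_pentagon:
  assumes "finite V" "{a, b, c, d, e} \<subseteq> V" "distinct [a, b, c, d, e]"
    "adj a b" "adj b c" "adj c d" "adj d e" "adj e a"
  shows "two_covered V {a, b, c, d, e}"
  using assms
  by (intro realizable_cong[OF realizable_add[OF realizable_add[OF realizable_add[OF realizable_add[OF
    realizable_edge[of V a b] realizable_edge[of V b c]] realizable_edge[of V c d]]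
    realizable_edge[of V d e]] realizable_edge[of V e a]]]) auto

text \<open>Deleting v leaves only its partner v' uncovered by \<open>p\<close>. Every failed
  exchange around v' yields nonedges, which form an independent half of the vertices or become too
  many. On six vertices the last count lacks a further pair to work with, hence the sharper bound
  \<open>six\<close>.\<close>

lemma two_covered_minus:
  assumes fin: "finite V" and p: "pairing p V" and v: "v \<in> V"
    and few: "card (nonedges V) + 2 \<le> card V"
    and six: "card V = 6 \<Longrightarrow> card (nonedges V) \<le> 3"
    and degree: "\<And>x u. x \<in> V \<Longrightarrow> \<exists>y\<in>V - {u}. adj x y"
    and half: "\<And>T. card V \<in> {4, 6, 8} \<Longrightarrow> T \<subseteq> V \<Longrightarrow> 2 * card T = card V \<Longrightarrow> \<not> independent T"
  shows "two_covered V (V - {v})"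
proof (rule ccontr)
  assume contra: "\<not> two_covered V (V - {v})"
  define v' where "v' = p v"
  define P where "P = V - {v, v'}"
  have pP: "pairing p P" unfolding P_def v'_def using pairing_remove[OF p v] .
  have pp: "p z \<in> P" "p (p z) = z" "adj z (p z)" "p z \<noteq> z" if "z \<in> P" for z
    using pP that pairing_neq by (auto simp: pairing_def)
  have v': "v' \<in> V" "v' \<noteq> v" "v' \<notin> P" "v \<notin> P"
    using p v pairing_neq[OF p v] by (auto simp: v'_def P_def pairing_def)
  have PV: "P \<subseteq> V" and Vv: "V - {v} = insert v' P" and finP: "finite P"
    using v' v fin by (auto simp: P_def)
  have cardP: "card V = card P + 2"
  proof -
    have "V = insert v (insert v' P)" using v v' by (auto simp: P_def)
    then show ?thesis using v' finP by simp
  qed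
  \<comment> \<open>The pairs of \<open>p\<close> not touched by an exchange are simply
    doubled.\<close>
  have rest: False if "two_covered V T" "pairing p Q" "Q \<subseteq> V" "Q \<inter> T = {}" "Q \<union> T = V - {v}" for Q T
  proof -
    have "matched Q" using that(2) by (auto simp: matched_def)
    then have "two_covered V (Q \<union> T)"
      using two_covered_matched[OF fin that(3)] that(1,4) by (intro two_covered_Un) auto
    then show False using that(5) contra by simp
  qed
  have triangle: "\<not> (adj v' a \<and> adj v' (p a))" if a: "a \<in> P" for a
  proof
    assume "adj v' a \<and> adj v' (p a)"
    then have "two_covered V {v', a, p a}"
      using pp[OF a] a PV v' fin adj_sym by (intro two_covered_triangle) auto
    then show False
      by (rule rest[OF _ pairing_remove[OF pP a]]) (use a pp[OF a] v' PV Vv in auto)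
  qed
  \<comment> \<open>The 5-cycle would be v', a, \<open>p a\<close>, \<open>p c\<close>, c.\<close>
  have pentagon: "\<not> adj (p a) (p c)" if ac: "a \<in> P" "c \<in> P" "a \<noteq> c" "adj v' a" "adj v' c" for a c
  proof
    assume "adj (p a) (p c)"
    have ne: "c \<noteq> p a" "p c \<noteq> a" "p c \<noteq> p a" using triangle[OF ac(1)] ac pp(2) by metis+
    have "two_covered V {v', a, p a, p c, c}"
      using \<open>adj (p a) (p c)\<close> ac ne pp[OF ac(1)] pp[OF ac(2)] PV v' fin adj_sym
      by (intro two_covered_pentagon) auto
    moreover have "pairing p (P - {a, p a} - {c, p c})"
      by (intro pairing_remove pP ac(1)) (use ac ne in auto)
    ultimately show False
      by (rule rest) (use ac ne pp[OF ac(1)] pp[OF ac(2)] v' PV Vv in auto)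
  qed
  \<comment> \<open>The exchange would double the edge v'a and use the triangle \<open>p a\<close>,
    c, \<open>p c\<close>.\<close>
  have edge_triangle: "\<not> (adj (p a) c \<and> adj (p a) (p c))"
    if ac: "a \<in> P" "c \<in> P" "c \<noteq> a" "c \<noteq> p a" "adj v' a" for a c
  proof
    assume "adj (p a) c \<and> adj (p a) (p c)"
    have ne: "p c \<noteq> a" "p c \<noteq> p a" using ac pp(2) by metis+
    have "two_covered V {p a, c, p c}"
      using \<open>adj (p a) c \<and> adj (p a) (p c)\<close> pp[OF ac(1)] pp[OF ac(2)] ac PV fin adj_sym
      by (intro two_covered_triangle) auto
    moreover have "two_covered V {v', a}"
      using ac PV v' fin by (intro two_covered_matched matched_pair) auto
    ultimately have "two_covered V ({p a, c, p c} \<union> {v', a})"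
      by (rule two_covered_Un) (use ac pp[OF ac(1)] pp[OF ac(2)] ne v' in auto)
    moreover have "pairing p (P - {a, p a} - {c, p c})"
      by (intro pairing_remove pP ac(1)) (use ac ne in auto)
    ultimately show False
      by (rule rest) (use ac ne pp[OF ac(1)] pp[OF ac(2)] v' PV Vv in auto)
  qed
  obtain a where a: "a \<in> P" "adj v' a"
  proof -
    obtain a where "a \<in> V - {v}" "adj v' a" using degree[OF v'(1)] by blast
    then show ?thesis using that[of a] v' by (cases "a = v'") (auto simp: P_def)
  qed
  define b where "b = p a"
  have b: "b \<in> P" "p b = a" "\<not> adj v' b" "b \<noteq> a"
    using pp[OF a(1)] triangle[OF a(1)] a(2) by (auto simp: b_def)
  show False
  proof (cases "\<exists>c\<in>P. \<not> adj v' c \<and> \<not> adj v' (p c)")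
    case False
    \<comment> \<open>Each pair in \<open>P\<close> now contains exactly one neighbour of v': at
      least one by the case assumption, at most one by \<open>triangle\<close>. So \<open>T\<close>
      has half of the vertices, and \<open>pentagon\<close> makes the partners independent.\<close>
    define T where "T = insert v' (p ` {c \<in> P. adj v' c})"
    have injp: "inj_on p P" using pp(2) by (metis inj_onI)
    have indep: "independent T"
    proof -
      have "\<not> adj v' (p c)" if "c \<in> P" "adj v' c" for c using triangle that by blast
      moreover have "\<not> adj (p c) (p e)" if "c \<in> P" "adj v' c" "e \<in> P" "adj v' e" for c e
        using pentagon[of c e] that by (cases "c = e") auto
      ultimately show ?thesis using adj_sym by (auto simp: T_def independent_def)
    qed
    have TV: "T \<subseteq> V" using pp PV v' by (auto simp: T_def)
    have "p ` {c \<in> P. adj v' c} = {c \<in> P. \<not> adj v' c}"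
    proof (intro equalityI subsetI)
      fix c assume "c \<in> {c \<in> P. \<not> adj v' c}"
      then have "p c \<in> {c \<in> P. adj v' c}" "c = p (p c)" using False pp[of c] by auto
      then show "c \<in> p ` {c \<in> P. adj v' c}" by blast
    qed (use triangle pp in auto)
    moreover have "card (p ` {c \<in> P. adj v' c}) = card {c \<in> P. adj v' c}"
      by (intro card_image inj_on_subset[OF injp]) auto
    moreover have "card {c \<in> P. adj v' c} + card {c \<in> P. \<not> adj v' c} = card P"
      using finP by (subst card_Un_disjoint[symmetric]) (auto intro!: arg_cong[of _ _ card])
    ultimately have "2 * card (p ` {c \<in> P. adj v' c}) = card P" by simp
    moreover have "v' \<notin> p ` {c \<in> P. adj v' c}" using pp v' by auto
    ultimately have cardT: "2 * card T = card V" using cardP finP by (simp add: T_def)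
    define t where "t = card T"
    have "card T choose 2 = card (nonedges T)"
      using n_subsets[OF finite_subset[OF TV fin], of 2] independent_nonedges[OF indep] by simp
    also have "\<dots> \<le> card (nonedges V)"
      using fin TV by (intro card_mono nonedges_mono) auto
    \<comment> \<open>With n = 2t, the bound (t choose 2) \<le> 2t - 2 leaves only t \<le> 4, that
      is, the orders covered by \<open>half\<close>.\<close>
    finally have "(t choose 2) + 2 \<le> 2 * t" using few cardT by (simp add: t_def)
    moreover have "even (t * (t - 1))" by (cases t) auto
    then obtain m where "t * (t - 1) = 2 * m" by (rule evenE)
    ultimately have "t * (t - 1) + 4 \<le> 4 * t" by (simp add: choose_two)
    moreover have "t * 4 \<le> t * (t - 1)" if "5 \<le> t"
      using that by (intro mult_le_mono2) simp
    ultimately have "t \<le> 4" by linarith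
    moreover have "t \<ge> 2"
    proof -
      have "card {a, b} \<le> card P" using finP a b by (intro card_mono) auto
      then show ?thesis using cardP cardT b by (simp add: t_def)
    qed
    ultimately have "t = 2 \<or> t = 3 \<or> t = 4" by auto
    then have "card V \<in> {4, 6, 8}" using cardT t_def by auto
    then show False using half TV cardT indep by blast
  next
    case True
    then obtain c1 where c1: "c1 \<in> P" "\<not> adj v' c1" "\<not> adj v' (p c1)" by blast
    \<comment> \<open>By \<open>edge_triangle\<close>, b misses c1 or its partner; either will do,
      as v' misses both.\<close>
    have "\<exists>c\<in>P. \<not> adj v' c \<and> \<not> adj v' (p c) \<and> \<not> adj b c"
    proof (cases "adj b c1")
      case True
      have "c1 \<noteq> a" "c1 \<noteq> b" using c1 a b by auto
      then have "\<not> adj b (p c1)"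
        using edge_triangle[of a c1] True a c1 by (simp add: b_def)
      then show ?thesis using c1 pp(1,2)[OF c1(1)] by (intro bexI[of _ "p c1"]) simp_all
    qed (use c1 in blast)
    then obtain c0 where c0: "c0 \<in> P" "\<not> adj v' c0" "\<not> adj v' (p c0)" "\<not> adj b c0" by blast
    have c0ne: "c0 \<noteq> a" "c0 \<noteq> b" "p c0 \<noteq> a" "p c0 \<noteq> b"
      using c0 a(2) b(2) pp(2)[OF c0(1)] by (metis b_def)+
    define Q where "Q = P - {a, b}"
    have pQ: "pairing p Q" unfolding Q_def b_def using pairing_remove[OF pP a(1)] .
    have Q: "p z \<in> Q" "p (p z) = z" "z \<in> P" "z \<noteq> b" "z \<noteq> v'" "z \<noteq> a" "z \<in> V" if "z \<in> Q" for z
      using pQ that v' PV by (auto simp: pairing_def Q_def)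
    \<comment> \<open>Each vertex of \<open>Q\<close> is charged a nonedge at v' or b; {b,
      \<open>p c\<close>} is one by \<open>pentagon\<close> applied to a and c.\<close>
    define g where "g c = (if adj v' c then {b, p c} else {v', c})" for c
    have injg: "inj_on g Q"
    proof (rule inj_onI)
      fix s t assume st: "s \<in> Q" "t \<in> Q" "g s = g t"
      have "p s \<noteq> v'" "p t \<noteq> v'" "v' \<noteq> b" using Q(5)[OF Q(1)] st b v' by auto
      then have "p s = p t \<or> s = t"
        using st(3) Q(4,5)[OF st(1)] Q(4,5)[OF st(2)]
        by (auto simp: g_def doubleton_eq_iff split: if_splits)
      then show "s = t" using Q(2)[OF st(1)] Q(2)[OF st(2)] by metis
    qed
    have g_non: "g c \<in> nonedges V" if c: "c \<in> Q" for c
    proof (cases "adj v' c")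
      case True
      then have "\<not> adj b (p c)" using pentagon[of a c] a Q[OF c] by (auto simp: b_def)
      then show ?thesis
        using True Q[OF c] Q[OF Q(1)[OF c]] b PV by (auto simp: g_def pair_in_nonedges)
    next
      case False
      then show ?thesis using Q[OF c] v' by (auto simp: g_def pair_in_nonedges)
    qed
    \<comment> \<open>These n - 2 nonedges all meet {v', b}; another one is found further below.\<close>
    define I where "I = insert {v', b} (insert {b, c0} (g ` Q))"
    have c0Q: "c0 \<in> Q" using c0 c0ne by (auto simp: Q_def)
    have not_in: "{v', b} \<notin> g ` Q" "{b, c0} \<notin> g ` Q" "{v', b} \<noteq> {b, c0}"
    proof -
      show "{v', b} \<notin> g ` Q"
      proof
        assume "{v', b} \<in> g ` Q"
        then obtain z where z: "z \<in> Q" "{v', b} = g z" by auto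
        then show False using Q[OF z(1)] Q[OF Q(1)[OF z(1)]]
          by (auto simp: g_def doubleton_eq_iff split: if_splits)
      qed
      show "{b, c0} \<notin> g ` Q"
      proof
        assume "{b, c0} \<in> g ` Q"
        then obtain z where z: "z \<in> Q" "{b, c0} = g z" by auto
        then have "adj v' z" "c0 = p z" using Q[OF z(1)] b v' c0ne c0
          by (auto simp: g_def doubleton_eq_iff split: if_splits)
        then show False using Q[OF z(1)] c0 by auto
      qed
      show "{v', b} \<noteq> {b, c0}" using v' c0 by (auto simp: doubleton_eq_iff)
    qed
    have I_sub: "I \<subseteq> nonedges V"
      using g_non c0 c0ne b v' PV by (auto simp: I_def pair_in_nonedges)
    have cardQ: "card P = card Q + 2"
    proof -
      have "P = insert a (insert b Q)" using a b by (auto simp: Q_def)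
      moreover have "finite Q" "a \<notin> Q" "b \<notin> Q" using finP by (auto simp: Q_def)
      ultimately show ?thesis using b by simp
    qed
    have finQ: "finite Q" using finP by (simp add: Q_def)
    have cardI: "card I = card V - 2"
      using not_in cardP cardQ finQ by (simp add: I_def card_image[OF injg])
    then have Ieq: "I = nonedges V"
      using I_sub few fin by (intro card_seteq) auto
    \<comment> \<open>Six vertices would give four nonedges against \<open>six\<close>. Hence
      \<open>Q\<close> contains a pair besides c0 and its partner.\<close>
    have V6: "card V \<noteq> 6" using six cardI Ieq by auto
    have Qc0: "Q - {c0, p c0} \<noteq> {}"
    proof
      assume "Q - {c0, p c0} = {}"
      then have "Q = {c0, p c0}" using c0Q Q(1)[OF c0Q] by auto
      then show False using V6 cardP cardQ pp[OF c0(1)] by auto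
    qed
    then obtain c where c: "c \<in> Q" "c \<noteq> c0" "c \<noteq> p c0" by auto
    have pc: "p c \<in> Q" "p c \<noteq> c0" "p c \<noteq> p c0"
      using Q[OF c(1)] Q[OF c0Q] c by metis+
    have meets: "v' \<in> e \<or> b \<in> e" if "e \<in> I" for e
      using that by (auto simp: I_def g_def)
    \<comment> \<open>Every nonedge meets {v', b}, so \<open>Q\<close> is a clique.\<close>
    have new: False if "{s, t} \<in> nonedges V" "s \<in> Q" "t \<in> Q" for s t
    proof -
      have "{s, t} \<in> I" using that Ieq by simp
      then show False using meets[of "{s, t}"] Q[OF that(2)] Q[OF that(3)] by auto
    qed
    \<comment> \<open>In the clique \<open>Q\<close> the vertices \<open>p z\<close>, c0,
      \<open>p c0\<close> form a triangle, which \<open>edge_triangle\<close> forbids next to the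
      edge v'z.\<close>
    have link: False if z: "z \<in> Q" "z \<noteq> c0" "z \<noteq> p c0" "adj v' z" for z
    proof -
      have pz: "p z \<in> Q" "p z \<noteq> c0" "p z \<noteq> p c0" 
        using Q[OF z(1)] Q[OF c0Q] z by metis+
      have "\<not> (adj (p z) c0 \<and> adj (p z) (p c0))"
        using edge_triangle[of z c0] z pz Q[OF z(1)] c0 by auto
      then show False
        using new[OF _ pz(1) c0Q] new[OF _ pz(1) Q(1)[OF c0Q]] pz Q[OF pz(1)] Q[OF c0Q] Q[OF Q(1)[OF c0Q]]
        by (auto simp: pair_in_nonedges)
    qed
    have far: "\<not> adj v' c" "\<not> adj v' (p c)" using link c pc by auto
    have "\<exists>z\<in>{c, p c}. \<not> adj b z"
      using edge_triangle[of a c] a c Q[OF c(1)] by (auto simp: b_def)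
    then obtain z where z: "z \<in> {c, p c}" "\<not> adj b z" by blast
    have zQ: "z \<in> Q" "z \<noteq> c0" "\<not> adj v' (p z)" using z c pc far Q[OF c(1)] by auto
    \<comment> \<open>The nonedge bz is the surplus one: \<open>g\<close> could only charge it to
      \<open>p z\<close>, which is not adjacent to v', and it is neither v'b nor bc0.\<close>
    have "{b, z} \<in> I"
      using Ieq z zQ Q[OF zQ(1)] b PV by (auto simp: pair_in_nonedges)
    then obtain e where e: "e \<in> Q" "{b, z} = g e"
      using zQ Q[OF zQ(1)] v' b by (auto simp: I_def doubleton_eq_iff)
    then have "adj v' e" "z = p e" using Q[OF zQ(1)] Q[OF e(1)] b v'
      by (auto simp: g_def doubleton_eq_iff split: if_splits)
    then show False using zQ Q[OF e(1)] by auto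
  qed
qed

section \<open>Combining matchings into the required vertex sums\<close>

text \<open>The construction depends on the parity of the order. \<open>degree\<close> is minimum
  degree two, in the form that a neighbour survives the deletion of any u; \<open>five\<close>
  excludes the star left after deleting one of five vertices.\<close>

lemma critical_sums_realizable:
  assumes fin: "finite V"
    and few: "card (nonedges V) + 2 \<le> card V"
    and six: "card V = 6 \<Longrightarrow> card (nonedges V) \<le> 3"
    and degree: "\<And>x u. x \<in> V \<Longrightarrow> \<exists>y\<in>V - {u}. adj x y"
    and half: "\<And>T. card V \<in> {4, 6, 8} \<Longrightarrow> T \<subseteq> V \<Longrightarrow> 2 * card T = card V \<Longrightarrow> \<not> independent T"
    and five: "\<And>T. card V = 5 \<Longrightarrow> T \<subseteq> V \<Longrightarrow> card T = 3 \<Longrightarrow> \<not> independent T"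
    and k: "odd k" "1 \<le> d" "d < k" "even (card V + d)" and v: "v \<in> V"
  shows "realizable V (\<lambda>x. if x = v then k - d else k)"
proof (cases "even (card V)")
  case True
  have "matched V"
  proof (rule near_complete_matched[OF fin True])
    show "card (nonedges V) < card V" using few by simp
    show "\<exists>y\<in>V. adj x y" if "x \<in> V" for x using degree[OF that] by blast
    \<comment> \<open>An independent triple gives three nonedges, while order 4 allows only
      two.\<close>
    fix T assume T: "card V = 4" "T \<subseteq> V" "card T = 3"
    show "\<not> independent T"
    proof
      assume "independent T"
      then have "card (nonedges T) = 3 choose 2"
        using n_subsets[OF finite_subset[OF T(2) fin], of 2] independent_nonedges T(3) by simp
      moreover have "card (nonedges T) \<le> card (nonedges V)"
        using fin T(2) by (intro card_mono nonedges_mono) auto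
      ultimately show False using few T(1) by (simp add: choose_two)
    qed
  qed
  then obtain p where p: "pairing p V" by (auto simp: matched_def)
  have "two_covered V (V - {v})"
    by (rule two_covered_minus[OF fin p v few six degree half])
  \<comment> \<open>The sum is k - d at v and (k - d) + d elsewhere; \<open>d div 2\<close> is exact
    because an even order makes d even.\<close>
  then have r: "realizable V (\<lambda>x. (k - d) * of_bool (x \<in> V) + (d div 2) * (2 * of_bool (x \<in> V - {v})))"
    by (intro realizable_add[OF realizable_mult[OF realizable_matched[OF fin subset_refl \<open>matched V\<close>]] realizable_mult])
  have "even d" using True k by simp
  then show ?thesis
    by (intro realizable_cong[OF r]) (use k in \<open>auto elim!: evenE\<close>)
next
  case False
  have near: "matched (V - {u})" if u: "u \<in> V" for u
  proof (rule near_complete_matched)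
    have c: "card V = Suc (card (V - {u}))" using card_Suc_Diff1[OF fin u] by simp
    show "even (card (V - {u}))" using False c by simp
    have "card (nonedges (V - {u})) \<le> card (nonedges V)"
      using fin by (intro card_mono nonedges_mono) auto
    then show "card (nonedges (V - {u})) < card (V - {u})" using few c by simp
    show "\<exists>y\<in>V - {u}. adj x y" if "x \<in> V - {u}" for x using degree that by blast
    show "\<not> independent T" if "card (V - {u}) = 4" "T \<subseteq> V - {u}" "card T = 3" for T
      using five[of T] that c by auto
  qed (use fin in auto)
  obtain w where w: "w \<in> V" "adj v w" using degree[OF v] by blast
  then have "v \<noteq> w" by auto
  \<comment> \<open>An odd order makes d odd, so k - d is even.\<close>
  define h where "h = (k - d) div 2"
  have h: "k - d = 2 * h" using False k by (auto simp: h_def)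
  \<comment> \<open>The bracket is 0 + 1 + 1 at v, 1 + 0 + 1 at w and 1 + 1 + 0 elsewhere; d is then
    added everywhere except at v.\<close>
  have "realizable V (\<lambda>x. h * (of_bool (x \<in> V - {v}) + of_bool (x \<in> V - {w}) + of_bool (x \<in> {v, w}))
      + d * of_bool (x \<in> V - {v}))"
    using fin v w near by (intro realizable_add realizable_mult realizable_matched realizable_edge) auto
  then show ?thesis
    by (rule realizable_cong) (use h k \<open>v \<noteq> w\<close> in \<open>auto simp: algebra_simps\<close>)
qed

end

subsection \<open>Criticality from vertex sums\<close>

lemma edge_set_simple_graph: "simple_graph G \<Longrightarrow> edge_set (edges G)"
  by unfold_locales (auto simp: simple_graph_def)

text \<open>Pair weights are collapsed to a function on edges. Its bound k is inherited from the
  vertex sum at an endpoint, which is k or k - d.\<close>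

lemma k_d_criticalI:
  assumes G: "simple_graph G"
    and real: "\<And>v. v \<in> verts G \<Longrightarrow>
      edge_set.realizable (edges G) (verts G) (\<lambda>x. if x = v then k - d else k)"
  shows "k_d_critical k d G"
  unfolding k_d_critical_def
proof
  fix v assume v: "v \<in> verts G"
  interpret edge_set "edges G" by (rule edge_set_simple_graph[OF G])
  have fin: "finite (verts G)" using G by (simp add: simple_graph_def)
  obtain w :: "'a \<Rightarrow> 'a \<Rightarrow> nat" where
    w: "\<And>x y. w x y = w y x" "\<And>x y. w x y \<noteq> 0 \<Longrightarrow> adj x y"
      "\<And>x. x \<in> verts G \<Longrightarrow> (\<Sum>y\<in>verts G. w x y) = (if x = v then k - d else k)"
    using real[OF v] unfolding realizable_def by blast
  \<comment> \<open>On an edge {x, y} the double sum is w x y + w y x.\<close>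
  define f where "f e = (\<Sum>x\<in>e. \<Sum>y\<in>e. w x y) div 2" for e
  have loop: "w x x = 0" for x using w(2)[of x x] by auto
  have f: "f {x, y} = w x y" if "x \<noteq> y" for x y
    using that w(1)[of x y] loop by (simp add: f_def)
  have adj_vert: "x \<in> verts G" "x \<noteq> y" if "adj x y" for x y
    using that G by (auto simp: adj_def simple_graph_def)
  have sums: "(\<Sum>e\<in>incident_edges G u. f e) = (\<Sum>y\<in>verts G. w u y)" if u: "u \<in> verts G" for u
  proof -
    have "incident_edges G u = (\<lambda>y. {u, y}) ` {y \<in> verts G. adj u y}"
    proof (intro equalityI subsetI)
      fix e assume "e \<in> incident_edges G u"
      then have e: "e \<in> edges G" "u \<in> e" by (auto simp: incident_edges_def)
      then obtain y where "e = {u, y}" using card_edge[OF e(1)] by (auto simp: card_2_iff)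
      moreover have "adj y u" using e calculation by (simp add: adj_def insert_commute)
      ultimately show "e \<in> (\<lambda>y. {u, y}) ` {y \<in> verts G. adj u y}"
        using adj_vert adj_sym by blast
    qed (auto simp: incident_edges_def adj_def)
    moreover have "inj_on (\<lambda>y. {u, y}) {y \<in> verts G. adj u y}"
      by (auto simp: inj_on_def doubleton_eq_iff)
    ultimately have "(\<Sum>e\<in>incident_edges G u. f e) = (\<Sum>y\<in>{y \<in> verts G. adj u y}. f {u, y})"
      by (simp add: sum.reindex)
    also have "\<dots> = (\<Sum>y\<in>{y \<in> verts G. adj u y}. w u y)"
      using adj_vert f by (intro sum.cong) auto
    also have "\<dots> = (\<Sum>y\<in>verts G. w u y)"
      using w(2) fin by (intro sum.mono_neutral_left) auto
    finally show ?thesis .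
  qed
  have "f e \<le> k" if e: "e \<in> edges G" for e
  proof -
    obtain x y where xy: "e = {x, y}" "x \<noteq> y" using card_edge[OF e] by (auto simp: card_2_iff)
    then have "x \<in> verts G" "y \<in> verts G" using e G by (auto simp: simple_graph_def)
    then have "w x y \<le> (\<Sum>y\<in>verts G. w x y)" using fin by (intro member_le_sum) auto
    then show ?thesis using w(3)[OF \<open>x \<in> verts G\<close>] f xy by (auto split: if_splits)
  qed
  then show "\<exists>f. k_matching k G f \<and> (\<Sum>e\<in>incident_edges G v. f e) = k - d \<and>
      (\<forall>u\<in>verts G - {v}. (\<Sum>e\<in>incident_edges G u. f e) = k)"
    using sums w(3) v by (intro exI[of _ f]) (auto simp: k_matching_def)
qed

text \<open>Edges and nonedges partition the pairs of vertices, so lower bounds on edges become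
  upper bounds on nonedges.\<close>

lemma card_nonedges_num_edges:
  assumes "simple_graph G"
  shows "num_edges G + card (edge_set.nonedges (edges G) (verts G)) = order G choose 2"
proof -
  interpret edge_set "edges G" by (rule edge_set_simple_graph[OF assms])
  have fin: "finite (verts G)" using assms by (simp add: simple_graph_def)
  have "edges G \<union> nonedges (verts G) = {e. e \<subseteq> verts G \<and> card e = 2}"
    using assms by (auto simp: simple_graph_def nonedges_def)
  moreover have "edges G \<subseteq> Pow (verts G)" using assms by (auto simp: simple_graph_def)
  then have "finite (edges G)" using fin by (simp add: finite_subset)
  then have "card (edges G \<union> nonedges (verts G)) = card (edges G) + card (nonedges (verts G))"
    using fin by (intro card_Un_disjoint) (auto simp: nonedges_def)
  ultimately show ?thesis
    using n_subsets[OF fin, of 2] by (simp add: num_edges_def order_def)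
qed

subsection \<open>The exceptional graphs\<close>

lemma edges_complete_graph: "{x, y} \<in> edges (complete_graph m) \<longleftrightarrow> x < m \<and> y < m \<and> x \<noteq> y"
  by (auto simp: complete_graph_def doubleton_eq_iff)

lemma edges_graph_union:
  "{Inl x, Inl y} \<in> edges (graph_union G H) \<longleftrightarrow> {x, y} \<in> edges G"
  "{Inr x', Inr y'} \<in> edges (graph_union G H) \<longleftrightarrow> {x', y'} \<in> edges H"
  "{Inl x, Inr y'} \<notin> edges (graph_union G H)"
  "{Inr x', Inl y} \<notin> edges (graph_union G H)"
proof -
  have l: "{Inl x, Inl y} = Inl ` e \<longleftrightarrow> {x, y} = e" for e :: "'a set"
    using inj_image_eq_iff[OF inj_Inl, of "{x, y}" e] by simp
  have r: "{Inr x', Inr y'} = Inr ` e \<longleftrightarrow> {x', y'} = e" for e :: "'b set"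
    using inj_image_eq_iff[OF inj_Inr, of "{x', y'}" e] by simp
  have "{Inl x, Inl y} \<noteq> Inr ` e" "{Inr x', Inr y'} \<noteq> Inl ` e'" for e :: "'b set" and e' :: "'a set"
    by blast+
  then show "{Inl x, Inl y} \<in> edges (graph_union G H) \<longleftrightarrow> {x, y} \<in> edges G"
    "{Inr x', Inr y'} \<in> edges (graph_union G H) \<longleftrightarrow> {x', y'} \<in> edges H"
    by (simp_all add: graph_union_def image_iff l r)
qed (auto simp: graph_union_def)

lemma edges_graph_join:
  "{Inl x, Inl y} \<in> edges (graph_join G H) \<longleftrightarrow> {x, y} \<in> edges G"
  "{Inr x', Inr y'} \<in> edges (graph_join G H) \<longleftrightarrow> {x', y'} \<in> edges H"
  "{Inl x, Inr y'} \<in> edges (graph_join G H) \<longleftrightarrow> x \<in> verts G \<and> y' \<in> verts H"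
  "{Inr x', Inl y} \<in> edges (graph_join G H) \<longleftrightarrow> y \<in> verts G \<and> x' \<in> verts H"
  by (auto simp: graph_join_def edges_graph_union doubleton_eq_iff)

lemma verts_simps [simp]:
  "verts (complete_graph m) = {..<m}" "verts (isolated_vertices m) = {..<m}"
  "edges (isolated_vertices m) = {}"
  "verts (graph_union G H) = Inl ` verts G \<union> Inr ` verts H"
  "verts (graph_join G H) = Inl ` verts G \<union> Inr ` verts H"
  by (auto simp: complete_graph_def isolated_vertices_def graph_union_def graph_join_def)

text \<open>Adjacency of distinct vertices depends only on membership in \<open>T\<close>, so
  arbitrary numberings of \<open>T\<close> and of its complement glue to an isomorphism.\<close>

lemma iso_complete_join_isolated:
  assumes G: "simple_graph G" and T: "T \<subseteq> verts G" "card T = t" "order G = s + t"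
    and edge: "\<And>x y. x \<in> verts G \<Longrightarrow> y \<in> verts G \<Longrightarrow>
      {x, y} \<in> edges G \<longleftrightarrow> x \<noteq> y \<and> \<not> (x \<in> T \<and> y \<in> T)"
  shows "G \<simeq>\<^sub>G graph_join (complete_graph s) (isolated_vertices t)"
proof -
  have fin: "finite (verts G)" using G by (simp add: simple_graph_def)
  then have finT: "finite T" using T finite_subset by blast
  have "card (verts G - T) = card {..<s}" "card T = card {..<t}"
    using T finT by (auto simp: card_Diff_subset order_def)
  then obtain g h where g: "bij_betw g (verts G - T) {..<s}" and h: "bij_betw h T {..<t}"
    using finite_same_card_bij[of "verts G - T" "{..<s}"] finite_same_card_bij[of T "{..<t}"] fin finT by auto
  define \<phi> :: "'a \<Rightarrow> nat + nat" where "\<phi> x = (if x \<in> T then Inr (h x) else Inl (g x))" for x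
  have gi: "g x = g y \<longleftrightarrow> x = y" if "x \<in> verts G - T" "y \<in> verts G - T" for x y
    using that g by (auto simp: bij_betw_def inj_on_def)
  have hi: "h x = h y \<longleftrightarrow> x = y" if "x \<in> T" "y \<in> T" for x y
    using that h by (auto simp: bij_betw_def inj_on_def)
  have gs: "g x < s" if "x \<in> verts G - T" for x using that g by (auto simp: bij_betw_def)
  have hs: "h x < t" if "x \<in> T" for x using that h by (auto simp: bij_betw_def)
  have "\<phi> ` verts G = \<phi> ` (verts G - T) \<union> \<phi> ` T" using T by blast
  also have "\<phi> ` (verts G - T) = Inl ` g ` (verts G - T)" by (auto simp: \<phi>_def)
  also have "\<phi> ` T = Inr ` h ` T" by (auto simp: \<phi>_def)
  finally have "\<phi> ` verts G = Inl ` {..<s} \<union> Inr ` {..<t}"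
    using g h by (simp add: bij_betw_def)
  moreover have "inj_on \<phi> (verts G)"
    by (auto simp: inj_on_def \<phi>_def gi hi)
  ultimately have "bij_betw \<phi> (verts G) (verts (graph_join (complete_graph s) (isolated_vertices t)))"
    by (simp add: bij_betw_def)
  moreover have "{x, y} \<in> edges G \<longleftrightarrow>
      {\<phi> x, \<phi> y} \<in> edges (graph_join (complete_graph s) (isolated_vertices t))"
    if "x \<in> verts G" "y \<in> verts G" for x y
    using that gi[of x y] gs hs
    by (auto simp: edge \<phi>_def edges_graph_join edges_complete_graph)
  ultimately show ?thesis unfolding graph_iso_def by blast
qed

text \<open>Here x is pendant at w and all vertices but x form a clique; w becomes the joining
  vertex and x the isolated vertex of the union.\<close>

lemma iso_pendant_complete:
  assumes G: "simple_graph G" and xw: "x \<in> verts G" "w \<in> verts G" "x \<noteq> w"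
    and edge: "\<And>y z. y \<in> verts G \<Longrightarrow> z \<in> verts G \<Longrightarrow>
      {y, z} \<in> edges G \<longleftrightarrow> y \<noteq> z \<and> (x \<in> {y, z} \<longrightarrow> w \<in> {y, z})"
  shows "G \<simeq>\<^sub>G graph_join (complete_graph 1) (graph_union (complete_graph (order G - 2)) (complete_graph 1))"
    (is "_ \<simeq>\<^sub>G ?H")
proof -
  define R where "R = verts G - {x, w}"
  have fin: "finite (verts G)" using G by (simp add: simple_graph_def)
  then have "card R = card {..<order G - 2}"
    using xw by (simp add: R_def card_Diff_subset order_def)
  then obtain g where g: "bij_betw g R {..<order G - 2}"
    using finite_same_card_bij[of R "{..<order G - 2}"] fin by (auto simp: R_def)
  define \<phi> :: "'a \<Rightarrow> nat + (nat + nat)" where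
    "\<phi> y = (if y = w then Inl 0 else if y = x then Inr (Inr 0) else Inr (Inl (g y)))" for y
  have gi: "g y = g z \<longleftrightarrow> y = z" if "y \<in> R" "z \<in> R" for y z
    using that g by (auto simp: bij_betw_def inj_on_def)
  have gs: "g y < order G - 2" if "y \<in> R" for y using that g by (auto simp: bij_betw_def)
  have "verts G = insert x (insert w R)" using xw by (auto simp: R_def)
  then have "\<phi> ` verts G = insert (\<phi> x) (insert (\<phi> w) (\<phi> ` R))" by simp
  also have "\<phi> x = Inr (Inr 0)" using xw by (simp add: \<phi>_def)
  also have "\<phi> w = Inl 0" by (simp add: \<phi>_def)
  also have "\<phi> ` R = Inr ` Inl ` g ` R" by (auto simp: \<phi>_def R_def)
  finally have "\<phi> ` verts G = verts ?H"
    using g by (auto simp: bij_betw_def)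
  moreover have "inj_on \<phi> (verts G)"
    using gi by (auto simp: inj_on_def \<phi>_def R_def)
  ultimately have "bij_betw \<phi> (verts G) (verts ?H)" by (simp add: bij_betw_def)
  \<comment> \<open>\<open>graph_iso\<close> also compares the degenerate pairs with equal
    entries.\<close>
  moreover have loop: "{\<phi> y, \<phi> y} \<notin> edges ?H" for y
    by (simp only: \<phi>_def edges_graph_join edges_graph_union edges_complete_graph split: if_splits) simp
  moreover have "{y, z} \<in> edges G \<longleftrightarrow> {\<phi> y, \<phi> z} \<in> edges ?H" if "y \<in> verts G" "z \<in> verts G" for y z
  proof (cases "y = z")
    case True
    then show ?thesis using edge[OF that] loop[of z] by simp
  next
    case False
    then show ?thesis
      using that gi[of y z] gs[of y] gs[of z] xw
      by (auto simp: edge \<phi>_def R_def edges_graph_join edges_graph_union edges_complete_graph)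
  qed
  ultimately show ?thesis unfolding graph_iso_def by blast
qed

text \<open>The pairs inside \<open>T\<close> already use up all the nonedges allowed, so every
  other pair is an edge.\<close>

lemma iso_of_independent:
  assumes G: "simple_graph G" and T: "T \<subseteq> verts G" "card T = t" "order G = s + t"
    and ind: "edge_set.independent (edges G) T"
    and few: "card (edge_set.nonedges (edges G) (verts G)) \<le> t choose 2"
  shows "G \<simeq>\<^sub>G graph_join (complete_graph s) (isolated_vertices t)"
proof (rule iso_complete_join_isolated[OF G T])
  interpret edge_set "edges G" by (rule edge_set_simple_graph[OF G])
  have fin: "finite (verts G)" using G by (simp add: simple_graph_def)
  have "nonedges T = nonedges (verts G)"
    using few n_subsets[OF finite_subset[OF T(1) fin], of 2] independent_nonedges[OF ind] T fin
    by (intro card_seteq nonedges_mono) auto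
  then show "{x, y} \<in> edges G \<longleftrightarrow> x \<noteq> y \<and> \<not> (x \<in> T \<and> y \<in> T)"
    if "x \<in> verts G" "y \<in> verts G" for x y
    unfolding adj_def[symmetric]
    using that pair_in_nonedges[of x y T] pair_in_nonedges[of x y "verts G"] ind
    by (cases "x = y") (auto simp: independent_def)
qed

text \<open>The nonedges from x to all vertices except u already number n - 2, so there are no
  others and x is pendant at u.\<close>

lemma degree_ge_two_or_pendant:
  assumes G: "simple_graph G" and n: "order G \<ge> 3"
    and few: "card (edge_set.nonedges (edges G) (verts G)) + 2 \<le> order G"
    and x: "x \<in> verts G" and all: "\<And>y. y \<in> verts G - {u} \<Longrightarrow> {x, y} \<notin> edges G"
  shows "card (edge_set.nonedges (edges G) (verts G)) + 2 = order G"
    and "G \<simeq>\<^sub>G graph_join (complete_graph 1) (graph_union (complete_graph (order G - 2)) (complete_graph 1))"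
proof -
  interpret edge_set "edges G" by (rule edge_set_simple_graph[OF G])
  have fin: "finite (verts G)" using G by (simp add: simple_graph_def)
  define I where "I = (\<lambda>y. {x, y}) ` (verts G - {x, u})"
  have nbr: "\<forall>y\<in>verts G. adj x y \<longrightarrow> y = u"
    using all unfolding adj_def by blast
  have I_sub: "I \<subseteq> nonedges (verts G)"
    using x nbr by (auto simp: I_def pair_in_nonedges)
  have "inj_on (\<lambda>y. {x, y}) (verts G - {x, u})"
    by (auto simp: inj_on_def doubleton_eq_iff)
  then have cardI: "card I = card (verts G - {x, u})" by (simp add: I_def card_image)
  have le: "card I \<le> card (nonedges (verts G))" using I_sub fin by (intro card_mono) auto
  \<comment> \<open>If u were x or no vertex at all, x alone would account for n - 1
    nonedges.\<close>
  have "u \<in> verts G \<and> u \<noteq> x"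
  proof (rule ccontr)
    assume "\<not> ?thesis"
    then have "verts G - {x, u} = verts G - {x}" by auto
    then have "card I = order G - 1" using cardI x fin by (simp add: order_def)
    then show False using le few n by simp
  qed
  then have u: "u \<in> verts G" "u \<noteq> x" by auto
  have "card I = order G - 2" using cardI x u fin by (simp add: order_def card_Diff_subset)
  then show "card (nonedges (verts G)) + 2 = order G" using le few n by simp
  then have I: "I = nonedges (verts G)"
    using I_sub fin \<open>card I = order G - 2\<close> by (intro card_seteq) auto
  show "G \<simeq>\<^sub>G graph_join (complete_graph 1) (graph_union (complete_graph (order G - 2)) (complete_graph 1))"
  proof (rule iso_pendant_complete[OF G x u(1) u(2)[symmetric]])
    fix y z assume yz: "y \<in> verts G" "z \<in> verts G"
    have "adj y z \<longleftrightarrow> y \<noteq> z \<and> {y, z} \<notin> I"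
      using pair_in_nonedges[of y z "verts G"] yz I by (cases "y = z") auto
    also have "\<dots> \<longleftrightarrow> y \<noteq> z \<and> (x \<in> {y, z} \<longrightarrow> u \<in> {y, z})"
      using yz u by (auto simp: I_def doubleton_eq_iff)
    finally show "{y, z} \<in> edges G \<longleftrightarrow> y \<noteq> z \<and> (x \<in> {y, z} \<longrightarrow> u \<in> {y, z})"
      by (simp add: adj_def)
  qed
qed

section \<open>From the excluded graphs to criticality\<close>

text \<open>The excluded graphs supply the conditions on degrees and independent sets. For orders 4
  and 6 the bound \<open>four\<close> already rules out a vertex of degree at most one, so
  \<open>star\<close> concerns the other orders.\<close>

lemma near_complete_critical:
  assumes G: "simple_graph G" and n: "order G \<ge> 3"
    and k: "odd k" "1 \<le> d" "d < k" "even (order G + d)"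
    and few: "card (edge_set.nonedges (edges G) (verts G)) + 2 \<le> order G"
    and four: "order G \<in> {4, 6} \<Longrightarrow> card (edge_set.nonedges (edges G) (verts G)) + 3 \<le> order G"
    and star: "order G \<notin> {4, 6} \<Longrightarrow>
      \<not> G \<simeq>\<^sub>G graph_join (complete_graph 1) (graph_union (complete_graph (order G - 2)) (complete_graph 1))"
    and half: "order G \<in> {4, 6, 8} \<Longrightarrow>
      \<not> G \<simeq>\<^sub>G graph_join (complete_graph (order G div 2)) (isolated_vertices (order G div 2))"
    and five: "order G = 5 \<Longrightarrow> \<not> G \<simeq>\<^sub>G graph_join (complete_graph 2) (isolated_vertices 3)"
  shows "k_d_critical k d G"
proof (rule k_d_criticalI[OF G])
  interpret edge_set "edges G" by (rule edge_set_simple_graph[OF G])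
  fix v assume v: "v \<in> verts G"
  show "realizable (verts G) (\<lambda>x. if x = v then k - d else k)"
  proof (rule critical_sums_realizable)
    show "finite (verts G)" using G by (simp add: simple_graph_def)
    show "card (nonedges (verts G)) + 2 \<le> card (verts G)" using few by (simp add: order_def)
    show "card (nonedges (verts G)) \<le> 3" if "card (verts G) = 6"
      using four that by (simp add: order_def)
    show "\<exists>y\<in>verts G - {u}. adj x y" if x: "x \<in> verts G" for x u
    proof (rule ccontr)
      assume "\<not> ?thesis"
      then have "{x, y} \<notin> edges G" if "y \<in> verts G - {u}" for y using that by (auto simp: adj_def)
      from degree_ge_two_or_pendant[OF G n few x this] show False
        using four star by (cases "order G \<in> {4, 6}") auto
    qed
    show "\<not> independent T" if T: "card (verts G) \<in> {4, 6, 8}" "T \<subseteq> verts G" "2 * card T = card (verts G)" for T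
    proof
      assume ind: "independent T"
      \<comment> \<open>For orders 4, 6, 8 the binomial is 1, 3, 6, exactly the number of nonedges
        allowed.\<close>
      have "card (nonedges (verts G)) \<le> card T choose 2"
        using T few four by (auto simp: order_def choose_two)
      then have "G \<simeq>\<^sub>G graph_join (complete_graph (card T)) (isolated_vertices (card T))"
        using T by (intro iso_of_independent[OF G T(2) refl _ ind]) (simp_all add: order_def)
      moreover have "card T = order G div 2" using T by (simp add: order_def)
      ultimately show False using half T by (simp add: order_def)
    qed
    show "\<not> independent T" if T: "card (verts G) = 5" "T \<subseteq> verts G" "card T = 3" for T
    proof
      assume ind: "independent T"
      have "G \<simeq>\<^sub>G graph_join (complete_graph 2) (isolated_vertices 3)"
        using T few by (intro iso_of_independent[OF G T(2,3) _ ind]) (simp_all add: order_def choose_two)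
      then show False using five T by (simp add: order_def)
    qed
    show "even (card (verts G) + d)" using k by (simp add: order_def)
  qed (use k v in auto)
qed

theorem theorem5p1:
  fixes G :: "'a ugraph" and n k d :: nat
  assumes "simple_graph G" and "connected_graph G"
    and "order G = n" and "n \<ge> 3"
    and "odd k" and "k \<ge> 3"
    and "1 \<le> d" and "d < k" and "n mod 2 = d mod 2"
  shows
    "((n \<ge> 9 \<or> n = 3 \<or> n = 7) \<and> num_edges G \<ge> ((n - 1) choose 2) + 1 \<and>
        \<not> G \<simeq>\<^sub>G graph_join (complete_graph 1)
                  (graph_union (complete_graph (n - 2)) (complete_graph 1))
        \<longrightarrow> k_d_critical k d G) \<and>
     (n \<in> {4, 6} \<and> real (num_edges G) \<ge> (3 * real n ^ 2 - 2 * real n) / 8 \<and>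
        \<not> G \<simeq>\<^sub>G graph_join (complete_graph (n div 2)) (isolated_vertices (n div 2))
        \<longrightarrow> k_d_critical k d G) \<and>
     (n = 5 \<and> num_edges G \<ge> 7 \<and>
        \<not> G \<simeq>\<^sub>G graph_join (complete_graph 2) (isolated_vertices 3) \<and>
        \<not> G \<simeq>\<^sub>G graph_join (complete_graph 1)
                  (graph_union (complete_graph 3) (complete_graph 1))
        \<longrightarrow> k_d_critical k d G) \<and>
     (n = 8 \<and> num_edges G \<ge> 22 \<and>
        \<not> G \<simeq>\<^sub>G graph_join (complete_graph 4) (isolated_vertices 4) \<and>
        \<not> G \<simeq>\<^sub>G graph_join (complete_graph 1)
                  (graph_union (complete_graph 6) (complete_graph 1))
        \<longrightarrow> k_d_critical k d G)"
proof -
  define m where "m = card (edge_set.nonedges (edges G) (verts G))"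
  have m: "num_edges G + m = n choose 2"
    using card_nonedges_num_edges[OF assms(1)] assms(3) by (simp add: m_def)
  have par: "even (n + d)" using assms(9) by presburger
  note crit = near_complete_critical[OF assms(1) _ assms(5,7,8), unfolded assms(3), OF assms(4) par,
      folded m_def]
  \<comment> \<open>Passing from n - 1 to n adds n - 1 pairs, and the extra edge leaves at most n -
    2 nonedges.\<close>
  have first: "m + 2 \<le> n" if "((n - 1) choose 2) + 1 \<le> num_edges G"
  proof -
    have "n choose 2 = ((n - 1) choose 2) + (n - 1)"
      using assms(4) by (cases n) (auto simp: numeral_2_eq_2)
    then show ?thesis using that m assms(4) by linarith
  qed
  \<comment> \<open>The bound is 5 of 6 pairs for n = 4 and 12 of 15 for n = 6.\<close>
  have second: "m + 3 \<le> n" if "n \<in> {4, 6}" "real (num_edges G) \<ge> (3 * real n ^ 2 - 2 * real n) / 8"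
    using that m by (auto simp: choose_two)
  show ?thesis
  proof (intro conjI impI; elim conjE)
    assume "n \<ge> 9 \<or> n = 3 \<or> n = 7" "num_edges G \<ge> ((n - 1) choose 2) + 1"
      "\<not> G \<simeq>\<^sub>G graph_join (complete_graph 1) (graph_union (complete_graph (n - 2)) (complete_graph 1))"
    then show "k_d_critical k d G" by (intro crit) (use first in auto)
  next
    assume "n \<in> {4, 6}" "real (num_edges G) \<ge> (3 * real n ^ 2 - 2 * real n) / 8"
      "\<not> G \<simeq>\<^sub>G graph_join (complete_graph (n div 2)) (isolated_vertices (n div 2))"
    then show "k_d_critical k d G" by (intro crit) (use second in auto)
  next
    \<comment> \<open>Here at most 10 - 7 = 3 nonedges remain, and for n = 8 at most 28 - 22 = 6;
      both equal n - 2.\<close>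
    assume "n = 5" "num_edges G \<ge> 7"
      "\<not> G \<simeq>\<^sub>G graph_join (complete_graph 2) (isolated_vertices 3)"
      "\<not> G \<simeq>\<^sub>G graph_join (complete_graph 1) (graph_union (complete_graph 3) (complete_graph 1))"
    then show "k_d_critical k d G" by (intro crit) (use m in \<open>auto simp: choose_two\<close>)
  next
    assume "n = 8" "num_edges G \<ge> 22"
      "\<not> G \<simeq>\<^sub>G graph_join (complete_graph 4) (isolated_vertices 4)"
      "\<not> G \<simeq>\<^sub>G graph_join (complete_graph 1) (graph_union (complete_graph 6) (complete_graph 1))"
    then show "k_d_critical k d G" by (intro crit) (use m in \<open>auto simp: choose_two\<close>)
  qed
qed

end
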